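(* Let $m\ge1$, $S>0$ and $\sigma_j>0$ for $j=1,\dots,m$. For $b=(b_1,\dots,b_m)$ with all $b_j>0$, let $\bar\varepsilon_d(b):=\sum_{j=1}^m\sigma_j^2/b_j^2$. The solution of $$\min_{b>0}\Bigl\{\bar\varepsilon_d(b):\ \sum_{j=1}^m b_j\le S\Bigr\}$$ is $$b_j^*=\frac{S\,\sigma_j^{2/3}}{\sum_{i=1}^m\sigma_i^{2/3}},\qquad \bar\varepsilon_d^*=\bar\varepsilon_d(b^* )=\frac{\bigl(\sum_{j=1}^m\sigma_j^{2/3}\bigr)^3}{S^2}.$$ For a feasible $b$ define $\Gamma(b):=\bar\varepsilon_d(b)/\bar\varepsilon_d^*$. For the best fixed-$\alpha$ rule $b_j^{\rm fix}=S\sigma_j/\sum_i\sigma_i$ and the uniform-minutes rule $b_j^{\rm unif}=S/m$, the loss factors are $$\Gamma_{\rm fix}:=\Gamma(b^{\rm fix})=\frac{m\bigl(\sum_j\sigma_j\bigr)^2}{\bigl(\sum_j\sigma_j^{2/3}\bigr)^3},\qquad \Gamma_{\rm unif}:=\Gamma(b^{\rm unif})=\frac{m^2\sum_j\sigma_j^2}{\bigl(\sum_j\sigma_j^{2/3}\bigr)^3}.$$ Both factors are at least one, with equality if and only if all variances $\sigma_j^2$ are equal.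
   Context: A fixed-$\alpha$ rule assigns a common tail level $\alpha\in(0,1)$ to every surgery, giving buffers $b_j=\sigma_j\sqrt{(1-\alpha)/\alpha}$; the best such rule is the one that uses the whole budget, $\sum_j b_j=S$, which gives $b_j^{\rm fix}=S\sigma_j/\sum_i\sigma_i$. *)

theory Defs
  imports "HOL-Analysis.Analysis"
begin

text \<open>The surgeries $1,\dots,m$ are the elements of a finite index type \<open>'m\<close>, so that
  $m$ is \<open>CARD('m)\<close>, and $m \ge 1$ holds because types are nonempty.\<close>

definition eps_d :: "real ^ 'm \<Rightarrow> real ^ 'm \<Rightarrow> real" where
  "eps_d \<sigma> b = (\<Sum>j\<in>UNIV. (\<sigma> $ j)\<^sup>2 / (b $ j)\<^sup>2)"

definition feasible :: "real \<Rightarrow> (real ^ 'm) set" where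
  "feasible S = {b. (\<forall>j. 0 < b $ j) \<and> (\<Sum>j\<in>UNIV. b $ j) \<le> S}"

definition eps_opt :: "real \<Rightarrow> real ^ 'm \<Rightarrow> real" where
  "eps_opt S \<sigma> = (INF b\<in>feasible S. eps_d \<sigma> b)"

definition loss_factor :: "real \<Rightarrow> real ^ 'm \<Rightarrow> real ^ 'm \<Rightarrow> real" where
  "loss_factor S \<sigma> b = eps_d \<sigma> b / eps_opt S \<sigma>"

definition b_star :: "real \<Rightarrow> real ^ 'm \<Rightarrow> real ^ 'm" where
  "b_star S \<sigma> = (\<chi> j. S * (\<sigma> $ j) powr (2/3) / (\<Sum>i\<in>UNIV. (\<sigma> $ i) powr (2/3)))"

definition fixed_alpha_rule :: "real ^ 'm \<Rightarrow> real \<Rightarrow> real ^ 'm" where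
  "fixed_alpha_rule \<sigma> \<alpha> = (\<chi> j. \<sigma> $ j * sqrt ((1 - \<alpha>) / \<alpha>))"

definition b_fix :: "real \<Rightarrow> real ^ 'm \<Rightarrow> real ^ 'm" where
  "b_fix S \<sigma> = (\<chi> j. S * \<sigma> $ j / (\<Sum>i\<in>UNIV. \<sigma> $ i))"

definition b_unif :: "real \<Rightarrow> real ^ 'm" where
  "b_unif S = (\<chi> j. S / real CARD('m))"

end

(* The function 1/x^2 lies above its tangent at c, strictly away from c.  Taking c = b*_j and weighting
   with sigma_j^2, the slope sigma_j^2 / (b*_j)^3 does not depend on j, so summing the tangent inequalities
   leaves a bound in terms of the budget only.  As b* is the unique minimiser, a loss factor
   is 1 exactly when the rule coincides with b*. *)
theory Submission
  imports Defs
begin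

section \<open>Tangent bound for the inverse square, and positivity facts\<close>

lemma inverse_square_tangent:
  fixes x c :: real
  assumes "x > 0" "c > 0"
  shows "3 / c\<^sup>2 - 2 * x / c^3 \<le> 1 / x\<^sup>2"
    and "x \<noteq> c \<Longrightarrow> 3 / c\<^sup>2 - 2 * x / c^3 < 1 / x\<^sup>2"
proof -
  \<comment> \<open>Tangency makes \<open>c\<close> a double root of the gap; the remaining factor
    \<open>2 * x + c\<close> is positive, so the sign of the gap and its only positive zero can be
    read off.\<close>
  have eq: "1 / x\<^sup>2 - (3 / c\<^sup>2 - 2 * x / c^3) = (x - c)\<^sup>2 * (2 * x + c) / (x\<^sup>2 * c^3)"
    using assms by (simp add: divide_simps) (simp add: algebra_simps eval_nat_numeral)
  show "3 / c\<^sup>2 - 2 * x / c^3 \<le> 1 / x\<^sup>2"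
  proof -
    have "0 \<le> (x - c)\<^sup>2 * (2 * x + c) / (x\<^sup>2 * c^3)" using assms by simp
    then show ?thesis using eq by linarith
  qed
  show "3 / c\<^sup>2 - 2 * x / c^3 < 1 / x\<^sup>2" if "x \<noteq> c"
  proof -
    have "0 < (x - c)\<^sup>2 * (2 * x + c) / (x\<^sup>2 * c^3)"
      using assms that by (intro divide_pos_pos mult_pos_pos) auto
    then show ?thesis using eq by linarith
  qed
qed

lemma powr_two_thirds_cubed:
  fixes x :: real
  assumes "x > 0"
  shows "(x powr (2/3)) ^ 3 = x\<^sup>2"
proof -
  have "(x powr (2/3)) ^ 3 = x powr (2/3 * 3)"
    by (metis assms of_nat_numeral powr_gt_zero powr_powr powr_realpow)
  also have "\<dots> = x\<^sup>2" using assms powr_numeral by auto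
  finally show ?thesis .
qed

lemma sum_UNIV_pos:
  fixes f :: "'m::finite \<Rightarrow> real"
  assumes "\<And>j. f j > 0"
  shows "(\<Sum>j\<in>UNIV. f j) > 0"
  using assms by (intro sum_pos) auto

section \<open>The optimal buffers\<close>

context
  fixes S :: real and \<sigma> :: "real ^ 'm"
  assumes S: "S > 0" and pos: "\<And>j. \<sigma> $ j > 0"
begin

private abbreviation (input) "s j \<equiv> \<sigma> $ j powr (2/3)"
private abbreviation (input) "T \<equiv> \<Sum>i\<in>UNIV. s i"
private abbreviation (input) "A \<equiv> \<Sum>i\<in>UNIV. \<sigma> $ i"

private lemma s_pos: "s j > 0"
  using pos[of j] by simp

private lemma T_pos: "T > 0"
  by (rule sum_UNIV_pos) (rule s_pos)

private lemma A_pos: "A > 0"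
  by (rule sum_UNIV_pos) (rule pos)

private lemma s_cube: "s j ^ 3 = (\<sigma> $ j)\<^sup>2"
  by (rule powr_two_thirds_cubed[OF pos])

private lemma b_star_nth: "b_star S \<sigma> $ j = S * s j / T"
  by (simp add: b_star_def)

private lemma b_star_pos: "b_star S \<sigma> $ j > 0"
  unfolding b_star_nth using S s_pos T_pos by simp

private lemma sum_b_star: "(\<Sum>j\<in>UNIV. b_star S \<sigma> $ j) = S"
  unfolding b_star_nth
  using T_pos by (simp flip: sum_divide_distrib sum_distrib_left)

lemma b_star_feasible: "b_star S \<sigma> \<in> feasible S"
  unfolding feasible_def using b_star_pos sum_b_star by simp

text \<open>The Lagrange condition: times -2, the left side is the partial derivative of
  \<open>eps_d\<close> at \<open>b_star\<close>. The exponent 2/3 is chosen so that the cube of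
  \<open>s j\<close> cancels the variance.\<close>

private lemma slope_b_star: "(\<sigma> $ j)\<^sup>2 / (b_star S \<sigma> $ j) ^ 3 = T^3 / S^3"
  using S s_pos[of j] T_pos
  by (simp add: b_star_nth power_divide power_mult_distrib s_cube[symmetric])

private lemma value_b_star: "(\<sigma> $ j)\<^sup>2 / (b_star S \<sigma> $ j)\<^sup>2 = T^2 / S^2 * s j"
  using S s_pos[of j] T_pos
  by (simp add: b_star_nth s_cube[symmetric]) (simp add: field_simps power2_eq_square power3_eq_cube)

lemma eps_d_b_star: "eps_d \<sigma> (b_star S \<sigma>) = T^3 / S\<^sup>2"
  by (simp only: eps_d_def value_b_star flip: sum_distrib_left)
     (simp add: power2_eq_square power3_eq_cube)

lemma eps_d_b_star_less:
  assumes b: "b \<in> feasible S" and ne: "b \<noteq> b_star S \<sigma>"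
  shows "eps_d \<sigma> (b_star S \<sigma>) < eps_d \<sigma> b"
proof -
  have bpos: "b $ j > 0" for j using b by (simp add: feasible_def)
  have bS: "(\<Sum>j\<in>UNIV. b $ j) \<le> S" using b by (simp add: feasible_def)
  \<comment> \<open>The weighted tangent at the optimal buffer, evaluated at the buffer of the
    competitor \<open>b\<close>.\<close>
  define g where "g j = (\<sigma> $ j)\<^sup>2 * (3 / (b_star S \<sigma> $ j)\<^sup>2 - 2 * b $ j / (b_star S \<sigma> $ j)^3)" for j
  have g: "g j = 3 * (T\<^sup>2 / S\<^sup>2) * s j - 2 * (T^3 / S^3) * b $ j" for j
  proof -
    have "g j = 3 * ((\<sigma> $ j)\<^sup>2 / (b_star S \<sigma> $ j)\<^sup>2) - 2 * ((\<sigma> $ j)\<^sup>2 / (b_star S \<sigma> $ j)^3) * b $ j"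
      by (simp add: g_def algebra_simps)
    then show ?thesis by (simp only: slope_b_star value_b_star)
  qed
  have le: "g j \<le> (\<sigma> $ j)\<^sup>2 / (b $ j)\<^sup>2" for j
    using mult_left_mono[OF inverse_square_tangent(1)[OF bpos[of j] b_star_pos[of j]], of "(\<sigma> $ j)\<^sup>2"]
    by (simp add: g_def)
  \<comment> \<open>One differing coordinate gives one strict tangent inequality, which is enough to
    make the sum strict.\<close>
  obtain k where "b $ k \<noteq> b_star S \<sigma> $ k"
    using ne by (auto simp: vec_eq_iff)
  then have lt: "g k < (\<sigma> $ k)\<^sup>2 / (b $ k)\<^sup>2"
    using mult_strict_left_mono[OF inverse_square_tangent(2)[OF bpos[of k] b_star_pos[of k]], of "(\<sigma> $ k)\<^sup>2"] pos[of k]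
    by (simp add: g_def)
  \<comment> \<open>The optimal value, split as 3 - 2 copies of itself to match the sum of the
    tangents when the budget is exhausted. The total buffer enters with a negative coefficient, so
    spending less than \<open>S\<close> only raises the bound.\<close>
  have "T^3 / S\<^sup>2 = 3 * (T\<^sup>2 / S\<^sup>2) * T - 2 * (T^3 / S^3) * S"
    using S by (simp add: field_simps power2_eq_square power3_eq_cube)
  also have "\<dots> \<le> 3 * (T\<^sup>2 / S\<^sup>2) * T - 2 * (T^3 / S^3) * (\<Sum>j\<in>UNIV. b $ j)"
    using bS S T_pos by (intro diff_left_mono mult_left_mono) auto
  also have "\<dots> = (\<Sum>j\<in>UNIV. g j)"
    by (simp only: g sum_subtractf sum_distrib_left)
  also have "\<dots> < eps_d \<sigma> b"
    unfolding eps_d_def using le lt by (intro sum_strict_mono_ex1) auto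
  finally show ?thesis by (simp only: eps_d_b_star)
qed

lemma eps_d_b_star_le: "b \<in> feasible S \<Longrightarrow> eps_d \<sigma> (b_star S \<sigma>) \<le> eps_d \<sigma> b"
  using eps_d_b_star_less by (cases "b = b_star S \<sigma>") (auto simp: less_imp_le)

lemma is_arg_min_b_star_iff:
  "is_arg_min (eps_d \<sigma>) (\<lambda>b. b \<in> feasible S) b \<longleftrightarrow> b = b_star S \<sigma>"
  using b_star_feasible eps_d_b_star_less eps_d_b_star_le
  by (fastforce simp: is_arg_min_linorder)

section \<open>The optimal value and loss factors\<close>

lemma eps_opt_eq: "eps_opt S \<sigma> = eps_d \<sigma> (b_star S \<sigma>)"
  unfolding eps_opt_def
  using b_star_feasible eps_d_b_star_le by (intro cInf_eq_minimum) auto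

private lemma eps_opt_pos: "eps_opt S \<sigma> > 0"
  unfolding eps_opt_eq eps_d_b_star using S T_pos by simp

lemma loss_factor_ge_1: "b \<in> feasible S \<Longrightarrow> loss_factor S \<sigma> b \<ge> 1"
  using eps_d_b_star_le[of b] eps_opt_pos by (simp add: loss_factor_def eps_opt_eq)

lemma loss_factor_eq_1_iff:
  "b \<in> feasible S \<Longrightarrow> loss_factor S \<sigma> b = 1 \<longleftrightarrow> b = b_star S \<sigma>"
  using eps_d_b_star_less[of b] eps_opt_pos
  by (cases "b = b_star S \<sigma>") (auto simp: loss_factor_def eps_opt_eq)

section \<open>The fixed-level and uniform rules\<close>

private lemma b_fix_nth: "b_fix S \<sigma> $ j = S * \<sigma> $ j / A"
  by (simp add: b_fix_def)

lemma sum_b_fix: "(\<Sum>j\<in>UNIV. b_fix S \<sigma> $ j) = S"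
  unfolding b_fix_nth using A_pos by (simp flip: sum_divide_distrib sum_distrib_left)

lemma b_fix_feasible: "b_fix S \<sigma> \<in> feasible S"
  unfolding feasible_def using sum_b_fix S pos A_pos by (simp add: b_fix_nth)

private lemma sum_b_unif: "(\<Sum>j\<in>UNIV. (b_unif S :: real ^ 'm) $ j) = S"
  by (simp add: b_unif_def)

lemma b_unif_feasible: "(b_unif S :: real ^ 'm) \<in> feasible S"
  unfolding feasible_def using S sum_b_unif by (simp add: b_unif_def)

text \<open>Buffers proportional to \<sigma> make all summands equal. This evaluates every
  fixed-level rule, \<open>b_fix\<close> included.\<close>

lemma eps_d_scaled: "eps_d \<sigma> (\<chi> j. \<sigma> $ j * k) = real CARD('m) / k\<^sup>2"
proof -
  have "(\<sigma> $ j)\<^sup>2 / (\<sigma> $ j * k)\<^sup>2 = 1 / k\<^sup>2" for j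
    using pos[of j] by (simp add: power_mult_distrib)
  then show ?thesis by (simp add: eps_d_def)
qed

private lemma b_fix_scaled: "b_fix S \<sigma> = (\<chi> j. \<sigma> $ j * (S / A))"
  by (simp add: vec_eq_iff b_fix_nth)

text \<open>The map from \<alpha> to \<open>sqrt ((1 - \<alpha>) / \<alpha>)\<close> sends (0,1)
  onto the positive reals, so the fixed-level rules form the open ray through \<sigma> and can be
  parametrised by the scale \<open>k\<close>.\<close>

lemma fixed_alpha_rules:
  "(\<exists>\<alpha>. 0 < \<alpha> \<and> \<alpha> < 1 \<and> b = fixed_alpha_rule \<sigma> \<alpha>) \<longleftrightarrow> (\<exists>k>0. b = (\<chi> j. \<sigma> $ j * k))"
proof
  assume "\<exists>\<alpha>. 0 < \<alpha> \<and> \<alpha> < 1 \<and> b = fixed_alpha_rule \<sigma> \<alpha>"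
  then obtain \<alpha> where "0 < \<alpha>" "\<alpha> < 1" "b = fixed_alpha_rule \<sigma> \<alpha>" by blast
  then show "\<exists>k>0. b = (\<chi> j. \<sigma> $ j * k)"
    by (intro exI[of _ "sqrt ((1 - \<alpha>) / \<alpha>)"]) (simp add: fixed_alpha_rule_def)
next
  assume "\<exists>k>0. b = (\<chi> j. \<sigma> $ j * k)"
  then obtain k where k: "k > 0" "b = (\<chi> j. \<sigma> $ j * k)" by blast
  \<comment> \<open>The solution of \<open>(1 - \<alpha>) / \<alpha> = k\<^sup>2\<close>.\<close>
  define \<alpha> where "\<alpha> = 1 / (1 + k\<^sup>2)"
  have p: "1 + k\<^sup>2 > 0" by (simp add: add_pos_nonneg)
  have "(1 - \<alpha>) / \<alpha> = k\<^sup>2" using p by (simp add: \<alpha>_def field_simps)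
  then have "sqrt ((1 - \<alpha>) / \<alpha>) = k" using k by simp
  moreover have "0 < \<alpha>" "\<alpha> < 1" using p k by (simp_all add: \<alpha>_def)
  ultimately show "\<exists>\<alpha>. 0 < \<alpha> \<and> \<alpha> < 1 \<and> b = fixed_alpha_rule \<sigma> \<alpha>"
    using k by (intro exI[of _ \<alpha>]) (simp add: fixed_alpha_rule_def)
qed

text \<open>On the ray the objective is strictly decreasing in the scale \<open>k\<close>, and the
  budget allows exactly the scales up to \<open>S / A\<close>; the best rule therefore spends all of
  \<open>S\<close>.\<close>

lemma is_arg_min_b_fix_iff:
  "is_arg_min (eps_d \<sigma>)
     (\<lambda>b. b \<in> feasible S \<and> (\<exists>\<alpha>. 0 < \<alpha> \<and> \<alpha> < 1 \<and> b = fixed_alpha_rule \<sigma> \<alpha>)) b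
   \<longleftrightarrow> b = b_fix S \<sigma>" (is "is_arg_min _ ?P b \<longleftrightarrow> _")
proof -
  have P_fix: "?P (b_fix S \<sigma>)"
    unfolding fixed_alpha_rules using b_fix_feasible b_fix_scaled S A_pos
    by (auto intro!: exI[of _ "S / A"])
  have less: "eps_d \<sigma> (b_fix S \<sigma>) < eps_d \<sigma> c" if c: "?P c" and ne: "c \<noteq> b_fix S \<sigma>" for c
  proof -
    obtain k where k: "k > 0" "c = (\<chi> j. \<sigma> $ j * k)"
      using c unfolding fixed_alpha_rules by blast
    have "A * k \<le> S" using c k by (simp add: feasible_def sum_distrib_right)
    then have "k \<le> S / A" using A_pos by (simp add: field_simps)
    moreover have "k \<noteq> S / A" using ne k b_fix_scaled by auto
    ultimately have "k\<^sup>2 < (S / A)\<^sup>2" using k by (intro power_strict_mono) auto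
    then show ?thesis
      unfolding k(2) b_fix_scaled eps_d_scaled
      using k S A_pos by (intro divide_strict_left_mono) auto
  qed
  show ?thesis
  proof
    assume "is_arg_min (eps_d \<sigma>) ?P b"
    then have b: "?P b" "eps_d \<sigma> b \<le> eps_d \<sigma> (b_fix S \<sigma>)"
      using P_fix unfolding is_arg_min_linorder by blast+
    show "b = b_fix S \<sigma>" using less[OF b(1)] b(2) by linarith
  next
    assume b: "b = b_fix S \<sigma>"
    have "eps_d \<sigma> b \<le> eps_d \<sigma> c" if "?P c" for c
      using less[OF that] b by (cases "c = b_fix S \<sigma>") auto
    then show "is_arg_min (eps_d \<sigma>) ?P b"
      using P_fix b unfolding is_arg_min_linorder by blast
  qed
qed

text \<open>Both the rule's value and the optimum scale as the inverse square of \<open>S\<close>,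
  so the budget cancels.\<close>

lemma loss_factor_b_fix:
  "loss_factor S \<sigma> (b_fix S \<sigma>) = real CARD('m) * A\<^sup>2 / T ^ 3"
  unfolding loss_factor_def eps_opt_eq eps_d_b_star b_fix_scaled eps_d_scaled
  using S A_pos T_pos by (simp add: power_divide)

lemma loss_factor_b_unif:
  "loss_factor S \<sigma> (b_unif S) = (real CARD('m))\<^sup>2 * (\<Sum>j\<in>UNIV. (\<sigma> $ j)\<^sup>2) / T ^ 3"
proof -
  have "eps_d \<sigma> (b_unif S) = (real CARD('m))\<^sup>2 * (\<Sum>j\<in>UNIV. (\<sigma> $ j)\<^sup>2) / S\<^sup>2"
    by (simp add: eps_d_def b_unif_def power_divide sum_distrib_left sum_divide_distrib mult.commute)
  then show ?thesis
    unfolding loss_factor_def eps_opt_eq eps_d_b_star using S by simp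
qed

section \<open>When the two rules coincide with the optimum\<close>

private lemma equal_variances_iff:
  "(\<forall>i j. (\<sigma> $ i)\<^sup>2 = (\<sigma> $ j)\<^sup>2) \<longleftrightarrow> (\<forall>i j. s i = s j)"
  by (metis s_cube pos less_imp_le power2_eq_iff_nonneg)

lemma b_fix_eq_b_star_iff:
  "b_fix S \<sigma> = b_star S \<sigma> \<longleftrightarrow> (\<forall>i j. (\<sigma> $ i)\<^sup>2 = (\<sigma> $ j)\<^sup>2)"
proof
  assume eq: "b_fix S \<sigma> = b_star S \<sigma>"
  \<comment> \<open>Equating coordinates gives \<open>\<sigma> $ j = A / T * s j\<close>. Squaring
    turns the left side into the cube of \<open>s j\<close>, and cancelling the square of
    \<open>s j\<close> leaves a value free of \<open>j\<close>.\<close>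
  have "s j = (A / T)\<^sup>2" for j
  proof -
    have "S * \<sigma> $ j / A = S * s j / T"
      using eq b_fix_nth b_star_nth by metis
    then have "\<sigma> $ j = A / T * s j"
      using S A_pos T_pos by (simp add: field_simps)
    then have "s j * (s j)\<^sup>2 = (A / T)\<^sup>2 * (s j)\<^sup>2"
      using s_cube[of j] by (metis power_mult_distrib power_Suc numeral_3_eq_3 numeral_2_eq_2)
    then show ?thesis
      using s_pos[of j] by (metis mult_right_cancel less_irrefl zero_eq_power2)
  qed
  then show "\<forall>i j. (\<sigma> $ i)\<^sup>2 = (\<sigma> $ j)\<^sup>2"
    unfolding equal_variances_iff by metis
next
  assume "\<forall>i j. (\<sigma> $ i)\<^sup>2 = (\<sigma> $ j)\<^sup>2"
  \<comment> \<open>Here \<open>undefined\<close> merely serves as some fixed index, to name the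
    common value.\<close>
  then have "\<sigma> $ i = \<sigma> $ undefined" for i
    using pos by (metis less_imp_le power2_eq_iff_nonneg)
  then obtain c where c: "\<And>i. \<sigma> $ i = c" by blast
  have "c > 0" using pos c by metis
  then show "b_fix S \<sigma> = b_star S \<sigma>"
    by (simp add: vec_eq_iff b_fix_def b_star_def c)
qed

lemma b_unif_eq_b_star_iff:
  "b_unif S = b_star S \<sigma> \<longleftrightarrow> (\<forall>i j. (\<sigma> $ i)\<^sup>2 = (\<sigma> $ j)\<^sup>2)"
proof
  assume eq: "b_unif S = b_star S \<sigma>"
  \<comment> \<open>Equal buffers force each \<open>s j\<close> to be the average of them
    all.\<close>
  have "s j = T / real CARD('m)" for j
  proof -
    have "S / real CARD('m) = S * s j / T"
      using arg_cong[OF eq, of "\<lambda>v. v $ j"] b_star_nth by (simp add: b_unif_def)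
    then show ?thesis using S T_pos by (simp add: field_simps)
  qed
  then show "\<forall>i j. (\<sigma> $ i)\<^sup>2 = (\<sigma> $ j)\<^sup>2"
    unfolding equal_variances_iff by metis
next
  \<comment> \<open>Only \<open>s\<close> enters \<open>b_star\<close>, and \<open>b_unif\<close>
    does not involve \<sigma>, so a common value of \<open>s\<close> suffices.\<close>
  assume "\<forall>i j. (\<sigma> $ i)\<^sup>2 = (\<sigma> $ j)\<^sup>2"
  then obtain c where c: "\<And>i. s i = c" unfolding equal_variances_iff by blast
  have "c > 0" using s_pos c by metis
  then show "b_unif S = b_star S \<sigma>"
    by (simp add: vec_eq_iff b_unif_def b_star_def c)
qed

end

theorem mainTheorem3:
  fixes S :: real and \<sigma> :: "real ^ 'm"
  assumes "S > 0" and "\<And>j. \<sigma> $ j > 0"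
  shows
    "(\<forall>b. is_arg_min (eps_d \<sigma>) (\<lambda>b. b \<in> feasible S) b \<longleftrightarrow> b = b_star S \<sigma>) \<and>
     eps_opt S \<sigma> = eps_d \<sigma> (b_star S \<sigma>) \<and>
     eps_d \<sigma> (b_star S \<sigma>) = (\<Sum>j\<in>UNIV. (\<sigma> $ j) powr (2/3)) ^ 3 / S\<^sup>2 \<and>
     (\<forall>b. is_arg_min (eps_d \<sigma>)
            (\<lambda>b. b \<in> feasible S \<and> (\<exists>\<alpha>. 0 < \<alpha> \<and> \<alpha> < 1 \<and> b = fixed_alpha_rule \<sigma> \<alpha>)) b
          \<longleftrightarrow> b = b_fix S \<sigma>) \<and>
     (\<Sum>j\<in>UNIV. b_fix S \<sigma> $ j) = S \<and>
     (b_unif S :: real ^ 'm) \<in> feasible S \<and>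
     loss_factor S \<sigma> (b_fix S \<sigma>) =
       real CARD('m) * (\<Sum>j\<in>UNIV. \<sigma> $ j)\<^sup>2 / (\<Sum>j\<in>UNIV. (\<sigma> $ j) powr (2/3)) ^ 3 \<and>
     loss_factor S \<sigma> (b_unif S) =
       (real CARD('m))\<^sup>2 * (\<Sum>j\<in>UNIV. (\<sigma> $ j)\<^sup>2) / (\<Sum>j\<in>UNIV. (\<sigma> $ j) powr (2/3)) ^ 3 \<and>
     loss_factor S \<sigma> (b_fix S \<sigma>) \<ge> 1 \<and>
     loss_factor S \<sigma> (b_unif S) \<ge> 1 \<and>
     (loss_factor S \<sigma> (b_fix S \<sigma>) = 1 \<longleftrightarrow> (\<forall>i j. (\<sigma> $ i)\<^sup>2 = (\<sigma> $ j)\<^sup>2)) \<and>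
     (loss_factor S \<sigma> (b_unif S) = 1 \<longleftrightarrow> (\<forall>i j. (\<sigma> $ i)\<^sup>2 = (\<sigma> $ j)\<^sup>2))"
  using is_arg_min_b_star_iff[OF assms] eps_opt_eq[OF assms] eps_d_b_star[OF assms]
    is_arg_min_b_fix_iff[OF assms] sum_b_fix[OF assms] b_unif_feasible[OF assms]
    loss_factor_b_fix[OF assms] loss_factor_b_unif[OF assms]
    loss_factor_ge_1[OF assms b_fix_feasible[OF assms]]
    loss_factor_ge_1[OF assms b_unif_feasible[OF assms]]
    loss_factor_eq_1_iff[OF assms b_fix_feasible[OF assms], unfolded b_fix_eq_b_star_iff[OF assms]]
    loss_factor_eq_1_iff[OF assms b_unif_feasible[OF assms], unfolded b_unif_eq_b_star_iff[OF assms]]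
  by (intro conjI allI)

end
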